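(* Let $\mathbf{F}_q$ be a finite field with $q$ elements, $f\in MF_n^n(\mathbf{F}_q)$ a coupled monomial dynamical system and $G_f$ its dependency graph with vertex set $V_f$. Then $f$ is a fixed point system if the following properties hold: 1. The loop number of each nontrivial strongly connected component of $G_f$ is equal to $1$. 2. For each nontrivial strongly connected component $U\subseteq V_f$ and arbitrary $b,c\in U$, if $s_1(b,c)\neq 0$ then $s_1(b,c)=q-1$.
   Context: $E_q=\{0,1,\dots,q-1\}$; convention $x^0=1$ for all $x\in\mathbf{F}_q$. A monomial dynamical system $f\in MF_n^n(\mathbf{F}_q)$ ($n$ a positive integer) is a map $f:\mathbf{F}_q^n\to\mathbf{F}_q^n$ for which there is a (necessarily unique) $n\times n$ matrix $F$ with entries in $E_q$ such that $f_i(x)=x_1^{F_{i1}}\cdots x_n^{F_{in}}$ for all $x\in\mathbf{F}_q^n$ and all $i$. $f$ is a fixed point system if every trajectory $x,f(x),f^2(x),\dots$ ends in a fixed point of $f$; equivalently there is $m\ge1$ with $f^{m+\lambda}=f^m$ for all $\lambda\ge1$. The dependency graph $G_f$ of $f$ is the directed multigraph (self loops and parallel edges allowed) with vertex set $V_f=\{a_1,\dots,a_n\}$ and exactly $F_{ij}$ directed edges from $a_i$ to $a_j$ for all $i,j$. A sequence of length $s$ from $a$ to $b$ is a directed walk consisting of $s$ edges (repetitions allowed); sequences are different if the edges involved or their order differ. $s_m(a,b)$ is the number of different sequences of length $m$ from $a$ to $b$; in particular $s_1(b,c)$ is the number of edges $b\to c$. Strongly connected components are the usual ones; a strongly connected component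 is trivial if it consists of a single vertex $a$ and there is no edge $a\to a$. $f$ is coupled if $G_f$ contains nontrivial strongly connected components. The loop number of a vertex $a$ is the minimum of $|u-v|$ over all pairs $u\neq v$ such that there are sequences of length $u$ and of length $v$ from $a$ to $a$ (and $0$ if there is no sequence of positive length from $a$ to $a$). It is the same for all vertices of a nontrivial strongly connected component, and this common value is the loop number of the component. *)

theory Defs
  imports
    "HOL-Analysis.Analysis"
    "HOL-Computational_Algebra.Polynomial"
    "Graph_Theory.Digraph"
    "Graph_Theory.Digraph_Component"
    "Graph_Theory.Arc_Walk"
begin

section \<open>Monomial dynamical systems over a finite field\<close>

text \<open>
  The field with \<open>q\<close> elements is a type \<open>'a :: {field, finite}\<close> with \<open>q = CARD('a)\<close>, and
  \<open>n = CARD('n)\<close>. The convention \<open>x ^ 0 = 1\<close> (also for \<open>x = 0\<close>) is that of the library.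
\<close>

definition has_exponent_matrix ::
    "('a::{field,finite} ^ 'n \<Rightarrow> 'a ^ 'n) \<Rightarrow> nat ^ 'n ^ 'n \<Rightarrow> bool" where
  "has_exponent_matrix f F \<longleftrightarrow>
     (\<forall>i j. F $ i $ j \<in> {0..CARD('a) - 1}) \<and>
     (\<forall>x i. f x $ i = (\<Prod>j\<in>UNIV. (x $ j) ^ (F $ i $ j)))"

definition monomial_system :: "('a::{field,finite} ^ 'n \<Rightarrow> 'a ^ 'n) \<Rightarrow> bool" where
  "monomial_system f \<longleftrightarrow> (\<exists>F. has_exponent_matrix f F)"

definition exponent_matrix :: "('a::{field,finite} ^ 'n \<Rightarrow> 'a ^ 'n) \<Rightarrow> nat ^ 'n ^ 'n" where
  "exponent_matrix f = (THE F. has_exponent_matrix f F)"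

lemma power_fun_inj_aux:
  fixes a b :: nat
  assumes "a < b" "b \<le> CARD('a) - 1" and eq: "\<And>x :: 'a::{field,finite}. x ^ a = x ^ b"
  shows False
proof -
  define p :: "'a poly" where "p = monom 1 b - monom 1 a"
  have "coeff p b = 1" using assms(1) by (simp add: p_def)
  then have "p \<noteq> 0" by auto
  have "degree p \<le> b" unfolding p_def using assms(1)
    by (intro degree_diff_le) (auto intro: order_trans[OF degree_monom_le])
  moreover have "{x. poly p x = 0} = UNIV"
    by (auto simp: p_def poly_monom eq)
  ultimately have "CARD('a) \<le> b"
    using card_poly_roots_bound[OF \<open>p \<noteq> 0\<close>] by simp
  then show False using assms(2) zero_less_card_finite[where 'a='a] by linarith
qed

lemma power_fun_inj:
  fixes a b :: nat
  assumes "a \<le> CARD('a) - 1" "b \<le> CARD('a) - 1"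
    and "\<And>x :: 'a::{field,finite}. x ^ a = x ^ b"
  shows "a = b"
  using power_fun_inj_aux[of a b, where 'a='a] power_fun_inj_aux[of b a, where 'a='a] assms
  by (metis linorder_neqE_nat)

lemma has_exponent_matrix_unique:
  fixes f :: "'a::{field,finite} ^ 'n \<Rightarrow> 'a ^ 'n"
  assumes "has_exponent_matrix f F" "has_exponent_matrix f F'"
  shows "F = F'"
proof -
  have aux: "f (\<chi> k. if k = j then x else 1) $ i = x ^ (H $ i $ j)"
    if "has_exponent_matrix f H" for H i j and x :: 'a
  proof -
    have "f (\<chi> k. if k = j then x else 1) $ i
        = (\<Prod>k\<in>UNIV. (if k = j then x else 1) ^ (H $ i $ k))"
      using that by (simp add: has_exponent_matrix_def)
    also have "\<dots> = (\<Prod>k\<in>UNIV. if k = j then x ^ (H $ i $ j) else 1)"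
      by (intro prod.cong) auto
    finally show ?thesis by simp
  qed
  have "F $ i $ j = F' $ i $ j" for i j
  proof (rule power_fun_inj[where 'a='a])
    show "x ^ (F $ i $ j) = x ^ (F' $ i $ j)" for x :: 'a
      using aux[OF assms(1), of j x i] aux[OF assms(2), of j x i] by simp
  qed (use assms in \<open>auto simp: has_exponent_matrix_def\<close>)
  then show ?thesis by (simp add: vec_eq_iff)
qed

lemma exponent_matrix_eq: "has_exponent_matrix f F \<Longrightarrow> exponent_matrix f = F"
  unfolding exponent_matrix_def by (blast intro: has_exponent_matrix_unique)

lemma monomial_system_exponent_matrix:
  "monomial_system f \<Longrightarrow> has_exponent_matrix f (exponent_matrix f)"
  using exponent_matrix_eq unfolding monomial_system_def by metis

definition fixed_point_system :: "('s \<Rightarrow> 's) \<Rightarrow> bool" where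
  "fixed_point_system f \<longleftrightarrow> (\<forall>x. \<exists>m. f ((f ^^ m) x) = (f ^^ m) x)"


section \<open>The dependency graph\<close>

text \<open>The arcs \<open>(i, j, k)\<close>, \<open>k < F\<^sub>i\<^sub>j\<close>, are the parallel edges from \<open>i\<close> to \<open>j\<close>.\<close>

definition dependency_graph ::
    "('a::{field,finite} ^ 'n \<Rightarrow> 'a ^ 'n) \<Rightarrow> ('n, 'n \<times> 'n \<times> nat) pre_digraph" where
  "dependency_graph f =
     \<lparr> verts = UNIV,
       arcs = {(i, j, k). k < exponent_matrix f $ i $ j},
       tail = (\<lambda>(i, j, k). i),
       head = (\<lambda>(i, j, k). j) \<rparr>"

text \<open>
  Sequences are the walks \<^const>\<open>pre_digraph.awalk\<close>, given by their lists of arcs. The empty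
  walk at a vertex is a sequence of length \<open>0\<close>.
\<close>

definition num_sequences :: "('v, 'e) pre_digraph \<Rightarrow> nat \<Rightarrow> 'v \<Rightarrow> 'v \<Rightarrow> nat" where
  "num_sequences G m a b = card {p. pre_digraph.awalk G a p b \<and> length p = m}"

definition trivial_component :: "('v, 'e) pre_digraph \<Rightarrow> 'v set \<Rightarrow> bool" where
  "trivial_component G U \<longleftrightarrow> (\<exists>a. U = {a} \<and> \<not> a \<rightarrow>\<^bsub>G\<^esub> a)"

definition nontrivial_components :: "('v, 'e) pre_digraph \<Rightarrow> 'v set set" where
  "nontrivial_components G = {U \<in> pre_digraph.sccs_verts G. \<not> trivial_component G U}"

definition coupled :: "('a::{field,finite} ^ 'n \<Rightarrow> 'a ^ 'n) \<Rightarrow> bool" where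
  "coupled f \<longleftrightarrow> nontrivial_components (dependency_graph f) \<noteq> {}"

definition closed_length :: "('v, 'e) pre_digraph \<Rightarrow> 'v \<Rightarrow> nat \<Rightarrow> bool" where
  "closed_length G a u \<longleftrightarrow> (\<exists>p. pre_digraph.awalk G a p a \<and> length p = u)"

definition loop_number :: "('v, 'e) pre_digraph \<Rightarrow> 'v \<Rightarrow> nat" where
  "loop_number G a =
     (if \<exists>u>0. closed_length G a u
      then LEAST d. \<exists>u v. u \<noteq> v \<and> closed_length G a u \<and> closed_length G a v
                        \<and> d = nat \<bar>int u - int v\<bar>
      else 0)"

definition component_loop_number :: "('v, 'e) pre_digraph \<Rightarrow> 'v set \<Rightarrow> nat" where
  "component_loop_number G U = (THE l. \<forall>a\<in>U. loop_number G a = l)"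


section \<open>Consistency of the definitions\<close>

lemma fin_digraph_dependency_graph: "fin_digraph (dependency_graph f)"
proof
  have "arcs (dependency_graph f) =
      (\<Union>i. \<Union>j. (\<lambda>k. (i, j, k)) ` {..<exponent_matrix f $ i $ j})"
    by (auto simp: dependency_graph_def)
  then show "finite (arcs (dependency_graph f))" by simp
qed (auto simp: dependency_graph_def)

lemma num_sequences_1_dependency_graph:
  "num_sequences (dependency_graph f) 1 i j = exponent_matrix f $ i $ j"
proof -
  have "{p. pre_digraph.awalk (dependency_graph f) i p j \<and> length p = 1}
      = (\<lambda>k. [(i, j, k)]) ` {..<exponent_matrix f $ i $ j}"
    by (auto simp: dependency_graph_def pre_digraph.awalk_def pre_digraph.cas.simps
        length_Suc_conv)
  then show ?thesis
    by (simp add: num_sequences_def card_image inj_on_def)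
qed

lemma closed_length_transfer:
  assumes "wf_digraph G" "a \<rightarrow>\<^sup>*\<^bsub>G\<^esub> b" "b \<rightarrow>\<^sup>*\<^bsub>G\<^esub> a"
  shows "\<exists>k. (a \<noteq> b \<longrightarrow> k > 0) \<and> (\<forall>u. closed_length G a u \<longrightarrow> closed_length G b (u + k))"
proof -
  interpret wf_digraph G by fact
  obtain p r where p: "awalk a p b" and r: "awalk b r a"
    using assms(2,3) reachable_awalk by blast
  have "closed_length G b (u + (length p + length r))" if u: "closed_length G a u" for u
  proof -
    obtain c where "awalk a c a" "length c = u" using u by (auto simp: closed_length_def)
    then have "awalk b (r @ c @ p) b" using p r by (meson awalk_appendI)
    moreover have "length (r @ c @ p) = u + (length p + length r)"
      using \<open>length c = u\<close> by simp
    ultimately show ?thesis unfolding closed_length_def by blast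
  qed
  moreover have "length p + length r > 0" if "a \<noteq> b"
    using that p by (cases p) (auto simp: awalk_Nil_iff)
  ultimately show ?thesis by blast
qed

lemma loop_number_scc:
  assumes "wf_digraph G" "U \<in> pre_digraph.sccs_verts G" "a \<in> U" "b \<in> U"
  shows "loop_number G a = loop_number G b"
proof -
  let ?D = "\<lambda>a d. \<exists>u v. u \<noteq> v \<and> closed_length G a u \<and> closed_length G a v
                        \<and> d = nat \<bar>int u - int v\<bar>"
  have reach: "x \<rightarrow>\<^sup>*\<^bsub>G\<^esub> y" if "x \<in> U" "y \<in> U" for x y
    using assms(2) that by (auto simp: pre_digraph.sccs_verts_def)
  have imp: "?D y d" if xy: "x \<in> U" "y \<in> U" and D: "?D x d" for x y d
  proof -
    obtain k where k: "\<forall>u. closed_length G x u \<longrightarrow> closed_length G y (u + k)"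
      using closed_length_transfer[OF assms(1) reach[OF xy] reach[OF xy(2,1)]] by blast
    obtain u v where uv: "u \<noteq> v" "closed_length G x u" "closed_length G x v"
      "d = nat \<bar>int u - int v\<bar>" using D by blast
    have "u + k \<noteq> v + k" "d = nat \<bar>int (u + k) - int (v + k)\<bar>" using uv by auto
    then show ?thesis using k uv(2,3) by blast
  qed
  have pos: "\<exists>u>0. closed_length G y u"
    if xy: "x \<in> U" "y \<in> U" and D: "\<exists>u>0. closed_length G x u" for x y
    using closed_length_transfer[OF assms(1) reach[OF xy] reach[OF xy(2,1)]] D
    by (metis add_gr_0)
  have "?D a = ?D b" by (rule ext) (use imp assms(3,4) in blast)
  moreover have "(\<exists>u>0. closed_length G a u) = (\<exists>u>0. closed_length G b u)"
    using pos assms(3,4) by blast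
  ultimately show ?thesis unfolding loop_number_def by presburger
qed

lemma component_loop_number_eq:
  assumes "wf_digraph G" "U \<in> nontrivial_components G" "a \<in> U"
  shows "component_loop_number G U = loop_number G a"
  unfolding component_loop_number_def
proof (rule the_equality)
  show "\<forall>b\<in>U. loop_number G b = loop_number G a"
    using loop_number_scc[OF assms(1)] assms(2,3) by (auto simp: nontrivial_components_def)
next
  fix l assume "\<forall>b\<in>U. loop_number G b = l"
  then show "l = loop_number G a" using assms(3) by metis
qed

end

theory Submission
  imports Defs
begin

text \<open>
  Every coordinate of a trajectory is eventually constant with value \<open>0\<close> or \<open>1\<close>, by induction
  along the reachability order of the dependency graph. At a vertex on no cycle all
  successors are strictly lower and the claim is immediate. At a vertex \<open>i\<close> of a nontrivial
  component, the exponents \<open>q - 1\<close> turn the factors inside the component into \<open>0\<close> or \<open>1\<close>,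
  and the factors outside are \<open>0\<close> or \<open>1\<close> by induction. A zero propagates backwards along walks,
  and loop number \<open>1\<close> provides closed walks at \<open>i\<close> of all large lengths; so if the coordinate
  \<open>i\<close> ever vanishes, it eventually vanishes for good.
\<close>

text \<open>Multiplication by \<open>x\<close> permutes the nonzero elements, so their product
  \<open>?P\<close> equals \<open>x ^ (CARD('a) - 1) * ?P\<close>; as \<open>?P\<close> is nonzero,
  it cancels.\<close>

lemma power_card_minus_one:
  fixes x :: "'a::{field,finite}"
  assumes "x \<noteq> 0"
  shows "x ^ (CARD('a) - 1) = 1"
proof -
  let ?P = "\<Prod>y\<in>UNIV - {0::'a}. y"
  have "bij_betw ((*) x) (UNIV - {0}) (UNIV - {0})"
    by (rule bij_betw_byWitness[where f' = "\<lambda>y. y / x"]) (use assms in auto)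
  then have "?P = (\<Prod>y\<in>UNIV - {0}. x * y)"
    by (rule prod.reindex_bij_betw[symmetric])
  also have "\<dots> = x ^ (CARD('a) - 1) * ?P"
    by (simp add: prod.distrib card_Diff_singleton)
  finally show ?thesis
    by simp
qed

lemma power_in_zero_one: "x \<in> {0, 1} \<Longrightarrow> x ^ k \<in> {0, 1 :: 'a::semiring_1}"
  by (cases k) auto

lemma prod_in_zero_one:
  "(\<And>j. j \<in> A \<Longrightarrow> g j \<in> {0, 1 :: 'a::comm_semiring_1}) \<Longrightarrow> prod g A \<in> {0, 1}"
proof (induction A rule: infinite_finite_induct)
  case (insert x A)
  then have "g x \<in> {0, 1}" "prod g A \<in> {0, 1}" by blast+
  then show ?case using insert.hyps by auto
qed auto

text \<open>An arc from \<open>i\<close> to \<open>b\<close> means that coordinate \<open>b\<close>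
  occurs as a factor in component \<open>i\<close> of \<open>f\<close>. Hence a zero moves one arc
  backwards with each application of \<open>f\<close>.\<close>

lemma awalk_dependency_graph_zero:
  fixes f :: "'a::{field,finite} ^ 'n \<Rightarrow> 'a ^ 'n"
  assumes "has_exponent_matrix f F"
    and "pre_digraph.awalk (dependency_graph f) i p j" and "(f ^^ t) x $ j = 0"
  shows "(f ^^ (t + length p)) x $ i = 0"
proof -
  interpret fin_digraph "dependency_graph f" by (rule fin_digraph_dependency_graph)
  show ?thesis using assms(2)
  proof (induction p arbitrary: i)
    case Nil
    then show ?case using assms(3) by (simp add: awalk_Nil_iff)
  next
    case (Cons e p)
    obtain a b k where e: "e = (a, b, k)" by (cases e)
    have w: "awalk b p j" "i = a" "k < F $ i $ b"
      using Cons.prems[unfolded e awalk_Cons_iff] exponent_matrix_eq[OF assms(1)]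
      by (auto simp: dependency_graph_def)
    \<comment> \<open>The existence of the arc makes the exponent positive, which excludes the value
      \<open>0 ^ 0 = 1\<close>.\<close>
    have "((f ^^ (t + length p)) x $ b) ^ (F $ i $ b) = 0"
      using Cons.IH[OF w(1)] w(3) by simp
    then have "(\<Prod>c\<in>UNIV. ((f ^^ (t + length p)) x $ c) ^ (F $ i $ c)) = 0"
      by (intro prod_zero bexI[of _ b]) simp_all
    then have "f ((f ^^ (t + length p)) x) $ i = 0"
      using assms(1) by (simp only: has_exponent_matrix_def)
    then show ?case by simp
  qed
qed

lemma closed_length_add:
  assumes "wf_digraph G" "closed_length G a u" "closed_length G a v"
  shows "closed_length G a (u + v)"
proof -
  interpret wf_digraph G by fact
  obtain p r where "awalk a p a" "awalk a r a" "length p = u" "length r = v"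
    using assms(2,3) by (auto simp: closed_length_def)
  then have "awalk a (p @ r) a" "length (p @ r) = u + v" by auto
  then show ?thesis unfolding closed_length_def by blast
qed

lemma closed_length_mult:
  assumes "wf_digraph G" "closed_length G a u"
  shows "closed_length G a (k * u)"
proof (induction k)
  case 0
  interpret wf_digraph G by fact
  \<comment> \<open>The given closed walk serves here only to place \<open>a\<close> in the graph,
    as the empty walk at \<open>a\<close> requires.\<close>
  have "a \<in> verts G" using assms(2) by (auto simp: closed_length_def)
  then show ?case by (auto simp: closed_length_def awalk_Nil_iff)
next
  case (Suc k)
  then show ?case using closed_length_add[OF assms] by simp
qed

text \<open>Loop number 1 yields closed walks of consecutive lengths \<open>u\<close> and
  \<open>u + 1\<close>. Lengths of closed walks are closed under addition, and combinations of two
  consecutive numbers reach everything from \<open>u * u\<close> on.\<close>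

lemma loop_number_one_imp_eventually_closed_length:
  assumes "wf_digraph G" "loop_number G a = 1"
  shows "eventually (closed_length G a) sequentially"
proof -
  let ?D = "\<lambda>d. \<exists>u v. u \<noteq> v \<and> closed_length G a u \<and> closed_length G a v
                        \<and> d = nat \<bar>int u - int v\<bar>"
  interpret wf_digraph G by fact
  obtain w where w: "w > 0" "closed_length G a w"
    using assms(2) by (auto simp: loop_number_def split: if_splits)
  have "closed_length G a 0" using closed_length_mult[OF assms(1) w(2), of 0] by simp
  \<comment> \<open>The closed walk of length \<open>w\<close> and the empty one differ by
    \<open>w\<close>, so the \<open>LEAST\<close> ranges over a nonempty set and its value 1 is
    attained.\<close>
  have "?D w"
    by (intro exI[of _ w] exI[of _ 0]) (use w \<open>closed_length G a 0\<close> in simp)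
  moreover have "loop_number G a = (LEAST d. ?D d)"
    unfolding loop_number_def by (rule if_P) (use w in blast)
  ultimately have "?D 1" using LeastI[of ?D w] assms(2) by simp
  then obtain u where u: "closed_length G a u" "closed_length G a (Suc u)"
  proof -
    obtain r s where rs: "r \<noteq> s" "closed_length G a r" "closed_length G a s"
      "1 = nat \<bar>int r - int s\<bar>"
      using \<open>?D 1\<close> by blast
    then have "s = Suc r \<or> r = Suc s" by linarith
    then show thesis using rs that by blast
  qed
  have "closed_length G a m" if "m \<ge> u * u" for m
  proof (cases "u = 0")
    case True
    then show ?thesis using closed_length_mult[OF assms(1) u(2), of m] by simp
  next
    case False
    \<comment> \<open>The division \<open>m = k * u + r\<close> is rewritten as
      \<open>(k - r) * u + r * (u + 1)\<close>. The bound \<open>u * u\<close> gives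
      \<open>r < u \<le> k\<close>, so the subtraction is not truncated.\<close>
    define k r where "k = m div u" and "r = m mod u"
    have "u \<le> k" unfolding k_def using that False by (simp add: less_eq_div_iff_mult_less_eq)
    moreover have "r < u" using False by (simp add: r_def)
    ultimately have "(k - r) * u + r * Suc u = k * u + r"
      by (simp add: diff_mult_distrib)
    also have "\<dots> = m" by (simp add: k_def r_def)
    finally show ?thesis
      using closed_length_add[OF assms(1) closed_length_mult[OF assms(1) u(1), of "k - r"]
          closed_length_mult[OF assms(1) u(2), of r]] by simp
  qed
  then show ?thesis by (auto simp: eventually_sequentially)
qed

lemma nontrivial_component_of_cycle:
  assumes "wf_digraph G" "i \<rightarrow>\<^bsub>G\<^esub> k" "k \<rightarrow>\<^sup>*\<^bsub>G\<^esub> i"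
  shows "{j. i \<rightarrow>\<^sup>*\<^bsub>G\<^esub> j \<and> j \<rightarrow>\<^sup>*\<^bsub>G\<^esub> i} \<in> nontrivial_components G" (is "?U \<in> _")
proof -
  interpret wf_digraph G by fact
  have "k \<in> ?U" "i \<in> ?U" using assms adj_in_verts by auto
  then have "?U \<in> sccs_verts" unfolding sccs_verts_def using reachable_trans by blast
  \<comment> \<open>If \<open>?U\<close> were a single vertex, then \<open>k = i\<close>, and the
    edge from \<open>i\<close> to \<open>k\<close> would be a self loop.\<close>
  moreover have "\<not> trivial_component G ?U"
    using \<open>k \<in> ?U\<close> \<open>i \<in> ?U\<close> assms(2) unfolding trivial_component_def by (metis singletonD)
  ultimately show ?thesis by (simp add: nontrivial_components_def)
qed

text \<open>The induction measure is the number of vertices reachable from \<open>i\<close>; it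
  drops along every edge with no way back. Restricting the limits to 0 and 1 reduces the question to
  whether a coordinate vanishes.\<close>

lemma trajectory_coordinate_eventually_const:
  fixes f :: "'a::{field,finite} ^ 'n \<Rightarrow> 'a ^ 'n"
  assumes F: "has_exponent_matrix f F"
    and loop: "\<And>U. U \<in> nontrivial_components (dependency_graph f) \<Longrightarrow>
           component_loop_number (dependency_graph f) U = 1"
    and mult: "\<And>U b c. U \<in> nontrivial_components (dependency_graph f) \<Longrightarrow> b \<in> U \<Longrightarrow> c \<in> U \<Longrightarrow>
           F $ b $ c \<noteq> 0 \<Longrightarrow> F $ b $ c = CARD('a) - 1"
  shows "\<exists>c\<in>{0, 1}. \<forall>\<^sub>F m in sequentially. (f ^^ m) x $ i = c"
proof (induction "card {k. i \<rightarrow>\<^sup>*\<^bsub>dependency_graph f\<^esub> k}" arbitrary: i rule: less_induct)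
  case less
  define G where "G = dependency_graph f"
  interpret fin_digraph G unfolding G_def by (rule fin_digraph_dependency_graph)
  have adj: "i \<rightarrow>\<^bsub>G\<^esub> j \<longleftrightarrow> F $ i $ j \<noteq> 0" for i j
    using exponent_matrix_eq[OF F]
    by (force simp: G_def dependency_graph_def arcs_ends_def arc_to_ends_def)
  have verts: "verts G = UNIV" by (simp add: G_def dependency_graph_def)
  have step: "(f ^^ Suc m) x $ i = (\<Prod>j\<in>UNIV. ((f ^^ m) x $ j) ^ (F $ i $ j))" for m i
    using F by (simp add: has_exponent_matrix_def)
  have below: "\<exists>c\<in>{0, 1}. \<forall>\<^sub>F m in sequentially. (f ^^ m) x $ j = c"
    if j: "F $ i $ j \<noteq> 0" "\<not> j \<rightarrow>\<^sup>*\<^bsub>G\<^esub> i" for j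
  proof -
    \<comment> \<open>The inclusion is strict because \<open>i\<close> reaches itself but is not
      reachable from \<open>j\<close>.\<close>
    have "{k. j \<rightarrow>\<^sup>*\<^bsub>G\<^esub> k} \<subset> {k. i \<rightarrow>\<^sup>*\<^bsub>G\<^esub> k}"
      using j adj[of i j] verts by (auto intro: adj_reachable_trans)
    then have "card {k. j \<rightarrow>\<^sup>*\<^bsub>G\<^esub> k} < card {k. i \<rightarrow>\<^sup>*\<^bsub>G\<^esub> k}"
      by (intro psubset_card_mono) auto
    then show ?thesis using less[of j] by (simp add: G_def)
  qed
  show ?case
  proof (cases "\<exists>k. i \<rightarrow>\<^bsub>G\<^esub> k \<and> k \<rightarrow>\<^sup>*\<^bsub>G\<^esub> i")
    case False
    then have "\<forall>j. \<exists>c. F $ i $ j \<noteq> 0 \<longrightarrow> c \<in> {0, 1} \<and> (\<forall>\<^sub>F m in sequentially. (f ^^ m) x $ j = c)"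
      using below adj by blast
    then obtain c where c: "\<And>j. F $ i $ j \<noteq> 0 \<Longrightarrow> c j \<in> {0, 1}"
      "\<And>j. F $ i $ j \<noteq> 0 \<Longrightarrow> \<forall>\<^sub>F m in sequentially. (f ^^ m) x $ j = c j"
      by metis
    have "\<forall>\<^sub>F m in sequentially. \<forall>j. F $ i $ j \<noteq> 0 \<longrightarrow> (f ^^ m) x $ j = c j"
      by (intro eventually_all_finite) (use c(2) in \<open>auto simp: eventually_conj_iff\<close>)
    then have "\<forall>\<^sub>F m in sequentially. (f ^^ Suc m) x $ i = (\<Prod>j\<in>UNIV. c j ^ (F $ i $ j))"
      unfolding step
    proof eventually_elim
      case (elim m)
      \<comment> \<open>For \<open>F $ i $ j = 0\<close> nothing is known about \<open>c j\<close>,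
        but both factors are 1 by the convention on zero exponents.\<close>
      show ?case by (intro prod.cong refl) (metis elim power_0)
    qed
    then have "\<forall>\<^sub>F m in sequentially. (f ^^ m) x $ i = (\<Prod>j\<in>UNIV. c j ^ (F $ i $ j))"
      by (rule eventually_sequentially_Suc[THEN iffD1])
    moreover have "(\<Prod>j\<in>UNIV. c j ^ (F $ i $ j)) \<in> {0, 1}"
      proof (intro prod_in_zero_one)
      show "c j ^ (F $ i $ j) \<in> {0, 1}" for j
        using c(1)[of j] power_in_zero_one[of "c j"] by (cases "F $ i $ j = 0") auto
    qed
    ultimately show ?thesis by blast
  next
    case True
    define U where "U = {j. i \<rightarrow>\<^sup>*\<^bsub>G\<^esub> j \<and> j \<rightarrow>\<^sup>*\<^bsub>G\<^esub> i}"
    have U: "U \<in> nontrivial_components G" "i \<in> U"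
      using True nontrivial_component_of_cycle[OF wf_digraph_axioms] verts
      by (auto simp: U_def)
    have "loop_number G i = 1"
      using component_loop_number_eq[OF wf_digraph_axioms U] loop U(1) by (simp add: G_def)
    then obtain N where N: "\<And>k. k \<ge> N \<Longrightarrow> closed_length G i k"
      using loop_number_one_imp_eventually_closed_length[OF wf_digraph_axioms]
      by (auto simp: eventually_sequentially)
    have "\<forall>\<^sub>F m in sequentially. ((f ^^ m) x $ j) ^ (F $ i $ j) \<in> {0, 1}" for j
    proof (cases "F $ i $ j \<noteq> 0 \<and> \<not> j \<rightarrow>\<^sup>*\<^bsub>G\<^esub> i")
      case True
      then obtain c where c: "c \<in> {0, 1}" "\<forall>\<^sub>F m in sequentially. (f ^^ m) x $ j = c"
        using below by blast
      from c(2) show ?thesis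
        by eventually_elim (use c(1) power_in_zero_one in blast)
    next
      case False
      \<comment> \<open>Here the factor lies in \<open>{0, 1}\<close> at every time: either the
        exponent is 0, or \<open>j\<close> lies in \<open>U\<close> and the exponent
        \<open>CARD('a) - 1\<close> sends all nonzero values to 1.\<close>
      have "((f ^^ m) x $ j) ^ (F $ i $ j) \<in> {0, 1}" for m
      proof (cases "F $ i $ j = 0")
        case nz: False
        then have "j \<in> U" using False adj by (auto simp: U_def)
        then have "F $ i $ j = CARD('a) - 1" using mult U nz by (simp add: G_def)
        then show ?thesis
          using power_card_minus_one[of "(f ^^ m) x $ j"] nz
          by (cases "(f ^^ m) x $ j = 0") auto
      qed simp
      then show ?thesis by simp
    qed
    then have "\<forall>\<^sub>F m in sequentially. \<forall>j. ((f ^^ m) x $ j) ^ (F $ i $ j) \<in> {0, 1}"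
      by (intro eventually_all_finite)
    then have "\<forall>\<^sub>F m in sequentially. (f ^^ Suc m) x $ i \<in> {0, 1}"
      unfolding step by eventually_elim (intro prod_in_zero_one, blast)
    then have zo: "\<forall>\<^sub>F m in sequentially. (f ^^ m) x $ i \<in> {0, 1}"
      by (rule eventually_sequentially_Suc[THEN iffD1])
    show ?thesis
    proof (cases "\<exists>t. (f ^^ t) x $ i = 0")
      case True
      then obtain t where t: "(f ^^ t) x $ i = 0" by blast
      have "(f ^^ m) x $ i = 0" if m: "m \<ge> t + N" for m
      proof -
        \<comment> \<open>A closed walk of exactly this length carries the zero at \<open>i\<close>
          from time \<open>t\<close> to time \<open>m\<close>.\<close>
        have "closed_length G i (m - t)" using m by (intro N) simp
        then obtain p where "awalk i p i" "length p = m - t"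
          by (auto simp: closed_length_def)
        then show ?thesis
          using awalk_dependency_graph_zero[OF F _ t, of i p] m by (simp add: G_def)
      qed
      then show ?thesis by (auto simp: eventually_sequentially)
    next
      case False
      \<comment> \<open>A coordinate that never vanishes and is eventually 0 or 1 is eventually
        1.\<close>
      then show ?thesis using zo by auto
    qed
  qed
qed

theorem theorem49:
  fixes f :: "'a::{field,finite} ^ 'n \<Rightarrow> 'a ^ 'n"
  assumes "monomial_system f"
    and "coupled f"
    and "\<And>U. U \<in> nontrivial_components (dependency_graph f) \<Longrightarrow>
           component_loop_number (dependency_graph f) U = 1"
    and "\<And>U b c. U \<in> nontrivial_components (dependency_graph f) \<Longrightarrow> b \<in> U \<Longrightarrow> c \<in> U \<Longrightarrow>
           num_sequences (dependency_graph f) 1 b c \<noteq> 0 \<Longrightarrow>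
           num_sequences (dependency_graph f) 1 b c = CARD('a) - 1"
  shows "fixed_point_system f"
  unfolding fixed_point_system_def
proof
  fix x
  note F = monomial_system_exponent_matrix[OF assms(1)]
  have "\<exists>c. \<forall>\<^sub>F m in sequentially. (f ^^ m) x $ i = c" for i
    using trajectory_coordinate_eventually_const[OF F assms(3), of x i]
      assms(4)[unfolded num_sequences_1_dependency_graph] by blast
  then obtain c where "\<And>i. \<forall>\<^sub>F m in sequentially. (f ^^ m) x $ i = c i"
    by metis
  then have "\<forall>\<^sub>F m in sequentially. \<forall>i. (f ^^ m) x $ i = c i"
    by (intro eventually_all_finite)
  \<comment> \<open>Since there are finitely many coordinates, one threshold \<open>m\<close> serves
    them all; the states at \<open>m\<close> and \<open>Suc m\<close> then agree.\<close>
  then obtain m where "\<And>k i. k \<ge> m \<Longrightarrow> (f ^^ k) x $ i = c i"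
    by (auto simp: eventually_sequentially)
  then have "(f ^^ Suc m) x = (f ^^ m) x"
    unfolding vec_eq_iff by (metis le_refl le_SucI)
  then show "\<exists>m. f ((f ^^ m) x) = (f ^^ m) x" by auto
qed

end
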